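(* Let $d\ge1$ be an integer and let $G_n=(V(G_n),E(G_n))$, $|V(G_n)|=n$, be a sequence of locally tree-like $d$-regular graphs. Then for all $q\ge2$ and $w,B\ge0$, the limit $\varphi(w,B)=\lim_{n\to\infty}\frac1n\log Z_{G_n}(q,w,B)$ (in probability) exists and is given by $$\varphi(w,B)=\frac{\beta^*d}{2}+\frac12\log\big(e^{-B}(q-1)\big)+\varphi^{\mathrm{Ising}}(\beta^*,B^* ),$$ where $w=e^{\beta}-1$, $$\beta^*=\frac\beta4+\frac14\log\Big(1+\frac{e^\beta-1}{q-1}\Big),\qquad B^*=\frac d4\log\Big(\frac{1+w}{1+w/(q-1)}\Big)+\frac12\log\Big(\frac{e^B}{q-1}\Big).$$
   Context: For a finite graph $G$ and $\omega\in\{0,1\}^{E(G)}$, $\mathscr C(\omega)$ is the collection of connected components of $(V(G),\{e:\omega_e=1\})$ (isolated vertices are components), $|C|$ is the number of vertices of $C$, and $$Z_G(q,w,B)=\sum_{\omega\in\{0,1\}^{E(G)}}\prod_{e\in E(G)}w^{\omega_e}\prod_{C\in\mathscr C(\omega)}\big(1+(q-1)e^{-B|C|}\big).$$ A sequence of $d$-regular (possibly random) graphs $G_n$ is locally tree-like if it converges locally in probability to the rooted infinite $d$-regular tree (a tree in which every vertex has degree $d$), i.e., for each $r\ge0$ the proportion of vertices of $G_n$ whose $r$-neighbourhood is a tree tends to $1$ in probability. $\varphi^{\mathrm{Ising}}(\beta,B)$, for $\beta\ge0$ and $B\in\mathbb R$, is the pressure per particle of the Ising model on locally tree-like $d$-regular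 graphs: with $Z^{\mathrm{Ising}}_{G}(\beta,B)=\sum_{\sigma\in\{-1,1\}^{V(G)}}\exp\big(\beta\sum_{\{u,v\}\in E(G)}\sigma_u\sigma_v+B\sum_{v\in V(G)}\sigma_v\big)$, it is the limit in probability of $\frac1n\log Z^{\mathrm{Ising}}_{G_n}(\beta,B)$, which is known to exist and to depend only on $d,\beta,B$. *)

theory Defs
  imports "HOL-Probability.Probability"
begin

section \<open>Finite simple graphs\<close>

record 'v graph =
  verts :: "'v set"
  edges :: "'v set set"

definition finite_simple_graph :: "'v graph \<Rightarrow> bool" where
  "finite_simple_graph g \<longleftrightarrow>
     finite (verts g) \<and> edges g \<subseteq> {e. e \<subseteq> verts g \<and> card e = 2}"

definition regular_graph :: "nat \<Rightarrow> 'v graph \<Rightarrow> bool" where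
  "regular_graph d g \<longleftrightarrow> (\<forall>v\<in>verts g. card {e \<in> edges g. v \<in> e} = d)"

definition adj :: "'v set set \<Rightarrow> 'v rel" where
  "adj E = {(u, v). {u, v} \<in> E}"

definition components :: "'v set \<Rightarrow> 'v set set \<Rightarrow> 'v set set" where
  "components V E = V // {(u, v). u \<in> V \<and> v \<in> V \<and> (u, v) \<in> (adj E)\<^sup>*}"

definition is_cycle :: "'v graph \<Rightarrow> 'v list \<Rightarrow> bool" where
  "is_cycle g c \<longleftrightarrow>
     3 \<le> length c \<and> distinct c \<and> set c \<subseteq> verts g \<and>
     (\<forall>i<length c. {c ! i, c ! (Suc i mod length c)} \<in> edges g)"

definition is_tree :: "'v graph \<Rightarrow> bool" where
  "is_tree g \<longleftrightarrow>
     verts g \<noteq> {} \<and>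
     (\<forall>u\<in>verts g. \<forall>v\<in>verts g. (u, v) \<in> (adj (edges g))\<^sup>*) \<and>
     (\<nexists>c. is_cycle g c)"

text \<open>The subgraph induced by the vertices at graph distance at most \<open>r\<close> from \<open>v\<close>.\<close>

definition nbhd :: "'v graph \<Rightarrow> nat \<Rightarrow> 'v \<Rightarrow> 'v graph" where
  "nbhd g r v =
     (let W = {u \<in> verts g. \<exists>k\<le>r. (v, u) \<in> adj (edges g) ^^ k}
      in \<lparr>verts = W, edges = {e \<in> edges g. e \<subseteq> W}\<rparr>)"

section \<open>Partition functions\<close>

definition Z_RC :: "'v graph \<Rightarrow> real \<Rightarrow> real \<Rightarrow> real \<Rightarrow> real" where
  "Z_RC g q w B =
     (\<Sum>\<omega> \<in> edges g \<rightarrow>\<^sub>E {0, 1::nat}.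
        (\<Prod>e\<in>edges g. w ^ \<omega> e) *
        (\<Prod>C\<in>components (verts g) {e \<in> edges g. \<omega> e = 1}.
           1 + (q - 1) * exp (- B * real (card C))))"

text \<open>For an edge \<open>e = {u, v}\<close> the product of \<open>\<sigma>\<close> over \<open>e\<close> is \<open>\<sigma> u * \<sigma> v\<close>.\<close>

definition Z_Ising :: "'v graph \<Rightarrow> real \<Rightarrow> real \<Rightarrow> real" where
  "Z_Ising g \<beta> B =
     (\<Sum>\<sigma> \<in> verts g \<rightarrow>\<^sub>E {-1, 1::real}.
        exp (\<beta> * (\<Sum>e\<in>edges g. \<Prod>v\<in>e. \<sigma> v) + B * (\<Sum>v\<in>verts g. \<sigma> v)))"

section \<open>Sequences of random graphs\<close>

text \<open>
  A random graph is given by its law. Finite graphs with vertices in \<^typ>\<open>nat\<close> form a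
  countable set, so every law on them is a probability mass function; a deterministic graph
  \<open>g\<close> is \<open>return_pmf g\<close>.

  A \<open>d\<close>-regular graph on \<open>n\<close> vertices exists only if \<open>n * d\<close> is even, so the sequence
  \<open>G n\<close> is indexed by the elements \<open>n\<close> of an infinite set \<open>I\<close>, and all limits
  are taken as \<open>n\<close> tends to infinity within \<open>I\<close>. The values of \<open>G\<close> outside \<open>I\<close> are
  irrelevant.
\<close>

definition tendsto_in_prob ::
    "nat set \<Rightarrow> (nat \<Rightarrow> 'g pmf) \<Rightarrow> (nat \<Rightarrow> 'g \<Rightarrow> real) \<Rightarrow> real \<Rightarrow> bool" where
  "tendsto_in_prob I G X c \<longleftrightarrow>
     (\<forall>\<epsilon>>0. ((\<lambda>n. measure_pmf.prob (G n) {g. \<bar>X n g - c\<bar> > \<epsilon>}) \<longlongrightarrow> 0)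
             (inf sequentially (principal I)))"

definition regular_graph_seq :: "nat \<Rightarrow> nat set \<Rightarrow> (nat \<Rightarrow> nat graph pmf) \<Rightarrow> bool" where
  "regular_graph_seq d I G \<longleftrightarrow>
     infinite I \<and>
     (\<forall>n\<in>I. \<forall>g\<in>set_pmf (G n).
        finite_simple_graph g \<and> card (verts g) = n \<and> regular_graph d g)"

definition locally_tree_like :: "nat set \<Rightarrow> (nat \<Rightarrow> nat graph pmf) \<Rightarrow> bool" where
  "locally_tree_like I G \<longleftrightarrow>
     (\<forall>r. tendsto_in_prob I G
        (\<lambda>n g. real (card {v \<in> verts g. is_tree (nbhd g r v)}) / real n) 1)"

text \<open>
  \<open>\<phi> \<beta> B\<close>, for all \<open>\<beta> \<ge> 0\<close> and real \<open>B\<close>, is the pressure per particle of the Ising model on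
  locally tree-like \<open>d\<close>-regular graphs: the limit along every such sequence.
\<close>

definition is_Ising_pressure :: "nat \<Rightarrow> (real \<Rightarrow> real \<Rightarrow> real) \<Rightarrow> bool" where
  "is_Ising_pressure d \<phi> \<longleftrightarrow>
     (\<forall>\<beta>\<ge>0. \<forall>B. \<forall>I G. regular_graph_seq d I G \<longrightarrow> locally_tree_like I G \<longrightarrow>
        tendsto_in_prob I G (\<lambda>n g. ln (Z_Ising g \<beta> B) / real n) (\<phi> \<beta> B))"

end

theory Submission
  imports Defs
begin

text \<open>
  Write the component weight as \<open>1 + (q - 1) * exp (- B * card C)\<close>: each component receives one of
  two colours, with weight \<open>1\<close> for the first colour and \<open>(q - 1) * exp (- B * card C)\<close> for the
  second. If the component is a tree with \<open>k\<close> edges, then \<open>q - 1 = (q - 1) ^ card C / (q - 1) ^ k\<close>,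
  so that the second weight factorises over vertices and edges. Using the factorised weight for
  \<^emph>\<open>all\<close> components defines the rank-two approximation \<open>Z_rank2\<close>. Summing over the edge set first,
  with the colouring fixed, turns \<open>Z_rank2\<close> into a sum over spin configurations with a pair
  interaction, which on a regular graph is an explicit factor times an Ising partition function
  (\<open>sum_subgraphs_eq_sum_colourings\<close>, \<open>Z_rank2_eq_Z_Ising\<close>). This identity produces the
  parameters \<open>\<beta>'\<close> and \<open>B'\<close>.

  It remains to compare \<open>Z_rank2\<close> with \<open>Z_RC\<close>, edge set by edge set. A component with \<open>k\<close> edges
  satisfies \<open>card C \<le> k + 1\<close>, and since \<open>q - 1 \<ge> 1\<close>, this gives \<open>Z_rank2 \<le> Z_RC\<close>. In the other
  direction, the two weights agree for a tree, and for any other component they differ by at most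
  the factor \<open>q\<close>. A component that is not a tree contains a cycle; therefore it has at least \<open>m\<close>
  vertices, or the \<open>m\<^sup>2\<close>-neighbourhood of each of its vertices contains that cycle
  (\<open>card_nontree_components_le\<close>). On a locally tree-like graph with \<open>n\<close> vertices, the number of
  such components is thus at most \<open>n / m + o(n)\<close> for every \<open>m\<close>, and the two pressures have the
  same limit.
\<close>

section \<open>Edges and cycles\<close>

lemma ex_longest_list:
  assumes "finite V" and "P p0" and "\<And>p. P p \<Longrightarrow> distinct p \<and> set p \<subseteq> V"
  obtains p where "P p" and "\<And>p'. P p' \<Longrightarrow> length p' \<le> length p"
proof -
  have "length p < Suc (card V)" if "P p" for p
    using assms(1) assms(3)[OF that] by (metis card_mono distinct_card less_Suc_eq_le)
  with ex_has_greatest_nat[of P p0 length "Suc (card V)"] assms(2) that show ?thesis by force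
qed

lemma min_degree_two_imp_cycle:
  assumes fin: "finite V" and E: "E \<subseteq> {e. e \<subseteq> V \<and> card e = 2}" and ne: "V \<noteq> {}"
    and deg: "\<And>v. v \<in> V \<Longrightarrow> 2 \<le> card {e \<in> E. v \<in> e}"
  shows "\<exists>c. is_cycle \<lparr>verts = V, edges = E\<rparr> c"
proof -
  define P where "P p \<longleftrightarrow> p \<noteq> [] \<and> distinct p \<and> set p \<subseteq> V \<and> (\<forall>i. Suc i < length p \<longrightarrow> {p ! i, p ! Suc i} \<in> E)"
    for p
  obtain v0 where "v0 \<in> V" using ne by blast
  then have "P [v0]" by (auto simp: P_def)
  then obtain p where p: "P p" and longest: "\<And>p'. P p' \<Longrightarrow> length p' \<le> length p"
    using ex_longest_list[of V P "[v0]"] fin P_def by metis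
  define x where "x = p ! 0"
  have xV: "x \<in> V" using p by (auto simp: P_def x_def)
  \<comment> \<open>Otherwise \<open>y\<close> would extend the longest path \<open>p\<close>.\<close>
  have nbr_in_p: "y \<in> set p" if y: "{x, y} \<in> E" for y
  proof (rule ccontr)
    assume "y \<notin> set p"
    moreover have "y \<in> V" using y E by auto
    moreover have "{(y # p) ! i, (y # p) ! Suc i} \<in> E" if "Suc i < length (y # p)" for i
      using that p y by (cases i) (auto simp: P_def x_def insert_commute)
    ultimately have "P (y # p)" using p by (auto simp: P_def)
    from longest[OF this] show False by simp
  qed
  \<comment> \<open>One of the at least two edges at the end point \<open>x\<close> does not go to the next vertex of the
    path. It closes a cycle.\<close>
  have "\<exists>e. e \<in> {e \<in> E. x \<in> e} \<and> e \<noteq> {x, p ! 1}"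
  proof (rule ccontr)
    assume "\<not> ?thesis"
    then have "{e \<in> E. x \<in> e} \<subseteq> {{x, p ! 1}}" by blast
    then have "card {e \<in> E. x \<in> e} \<le> 1"
      using card_mono[of "{{x, p ! 1}}" "{e \<in> E. x \<in> e}"] by simp
    with deg[OF xV] show False by simp
  qed
  then obtain e where e: "e \<in> E" "x \<in> e" "e \<noteq> {x, p ! 1}" by blast
  then have "card e = 2" using E by auto
  with e(2) obtain y where y: "e = {x, y}" "x \<noteq> y"
    by (auto simp: card_2_iff)
  then obtain j where j: "j < length p" "p ! j = y"
    using nbr_in_p e by (metis in_set_conv_nth)
  have "j \<noteq> 0" using j y x_def by metis
  moreover have "j \<noteq> 1" using j y e by metis
  ultimately have j2: "2 \<le> j" by simp
  have "is_cycle \<lparr>verts = V, edges = E\<rparr> (take (Suc j) p)"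
    unfolding is_cycle_def graph.simps
  proof (intro conjI allI impI)
    show "3 \<le> length (take (Suc j) p)" using j j2 by simp
    show "distinct (take (Suc j) p)" using p by (simp add: P_def)
    show "set (take (Suc j) p) \<subseteq> V" using p set_take_subset[of "Suc j" p] by (auto simp: P_def)
    fix i assume i: "i < length (take (Suc j) p)"
    show "{take (Suc j) p ! i, take (Suc j) p ! (Suc i mod length (take (Suc j) p))} \<in> E"
    proof (cases "i = j")
      case True
      then show ?thesis using j e y by (simp add: x_def insert_commute)
    next
      case False
      then have "i < j" using i by simp
      then show ?thesis using j p by (simp add: P_def)
    qed
  qed
  then show ?thesis by blast
qed

lemma is_cycle_mono:
  assumes "is_cycle g c" "verts g \<subseteq> verts h" "edges g \<subseteq> edges h"
  shows "is_cycle h c"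
  using assms unfolding is_cycle_def by blast

text \<open>A nonempty forest has fewer edges than vertices. Vertices of degree at most one are removed
  until the minimum degree is two.\<close>

lemma many_edges_imp_cycle:
  assumes "finite V" "E \<subseteq> {e. e \<subseteq> V \<and> card e = 2}" "V \<noteq> {}" "card V \<le> card E"
  shows "\<exists>c. is_cycle \<lparr>verts = V, edges = E\<rparr> c"
  using assms
proof (induction "card V" arbitrary: V E rule: less_induct)
  case less
  note fin = less.prems(1) and E = less.prems(2)
  have finE: "finite E" using E fin by (auto intro: finite_subset[of E "Pow V"])
  show ?case
  proof (cases "\<forall>v\<in>V. 2 \<le> card {e \<in> E. v \<in> e}")
    case True
    then show ?thesis using min_degree_two_imp_cycle[OF less.prems(1-3)] by blast
  next
    case False
    then obtain v where v: "v \<in> V" "card {e \<in> E. v \<in> e} \<le> 1" by force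
    define E' where "E' = {e \<in> E. v \<notin> e}"
    have "E = E' \<union> {e \<in> E. v \<in> e}" "E' \<inter> {e \<in> E. v \<in> e} = {}" by (auto simp: E'_def)
    then have "card E = card E' + card {e \<in> E. v \<in> e}"
      using finE by (metis card_Un_disjoint finite_Un)
    then have c: "card (V - {v}) \<le> card E'" using v less.prems(4) fin by simp
    have E'': "E' \<subseteq> {e. e \<subseteq> V - {v} \<and> card e = 2}" using E by (auto simp: E'_def)
    have "V - {v} \<noteq> {}"
    proof
      assume "V - {v} = {}"
      then have "V = {v}" using v by auto
      then have "E = {}" using E by (auto simp: subset_singleton_iff)
      then show False using less.prems(4) \<open>V = {v}\<close> by simp
    qed
    then obtain cyc where "is_cycle \<lparr>verts = V - {v}, edges = E'\<rparr> cyc"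
      using less.hyps[OF card_Diff1_less[OF fin v(1)] _ E'' _ c] fin by blast
    then have "is_cycle \<lparr>verts = V, edges = E\<rparr> cyc"
      by (rule is_cycle_mono) (auto simp: E'_def)
    then show ?thesis by blast
  qed
qed

section \<open>Connected components\<close>

lemma sym_adj: "sym (adj A)"
  by (auto simp: sym_def adj_def insert_commute)

lemma equiv_connected:
  "equiv V {(u, v). u \<in> V \<and> v \<in> V \<and> (u, v) \<in> (adj A)\<^sup>*}"
proof (rule equivI)
  show "sym {(u, v). u \<in> V \<and> v \<in> V \<and> (u, v) \<in> (adj A)\<^sup>*}"
    using sym_rtrancl[OF sym_adj[of A]] by (auto simp: sym_def)
qed (auto simp: refl_on_def trans_def)

lemma finite_components: "finite V \<Longrightarrow> finite (components V A)"
  unfolding components_def by (rule finite_quotient) (auto simp: equiv_def refl_on_def)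

lemma component_subset: "C \<in> components V A \<Longrightarrow> C \<subseteq> V"
  unfolding components_def by (auto elim!: quotientE)

lemma component_nonempty: "C \<in> components V A \<Longrightarrow> C \<noteq> {}"
  unfolding components_def using in_quotient_imp_non_empty[OF equiv_connected] by blast

lemma Union_graph_components: "\<Union> (components V A) = V"
  unfolding components_def by (rule Union_quotient[OF equiv_connected])

lemma components_disjoint:
  "\<lbrakk>C \<in> components V A; D \<in> components V A; C \<noteq> D\<rbrakk> \<Longrightarrow> C \<inter> D = {}"
  unfolding components_def using quotient_disj[OF equiv_connected] by blast

lemma component_eq:
  assumes "C \<in> components V A" "u \<in> C"
  shows "C = {v \<in> V. (u, v) \<in> (adj A)\<^sup>*}"
proof -
  obtain x where x: "x \<in> V" "C = {v \<in> V. (x, v) \<in> (adj A)\<^sup>*}"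
    using assms(1) unfolding components_def by (auto elim!: quotientE)
  then have "(x, u) \<in> (adj A)\<^sup>*" using assms(2) by simp
  moreover from this have "(u, x) \<in> (adj A)\<^sup>*"
    using sym_rtrancl[OF sym_adj[of A]] by (auto dest: symD)
  ultimately show ?thesis unfolding x(2) by (auto intro: rtrancl_trans)
qed

lemma edge_in_component:
  assumes A: "A \<subseteq> {e. e \<subseteq> V \<and> card e = 2}" and "C \<in> components V A" "e \<in> A" "e \<inter> C \<noteq> {}"
  shows "e \<subseteq> C"
proof -
  obtain u v where uv: "e = {u, v}" using assms(1,3) by (auto simp: card_2_iff)
  have "(u, v) \<in> adj A" "(v, u) \<in> adj A"
    using uv assms(3) by (auto simp: adj_def insert_commute)
  moreover have "u \<in> V" "v \<in> V" using uv A assms(3) by auto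
  ultimately show ?thesis using assms(4) component_eq[OF assms(2)] uv by blast
qed

text \<open>A connected set contains at least as many edges as a spanning tree. In a breadth-first tree
  with root \<open>r\<close>, the edge to the parent determines the vertex.\<close>

lemma card_component_le:
  assumes fin: "finite V" and A: "A \<subseteq> {e. e \<subseteq> V \<and> card e = 2}" and C: "C \<in> components V A"
  shows "card C \<le> Suc (card {e \<in> A. e \<subseteq> C})"
proof -
  obtain r where r: "r \<in> C" using component_nonempty[OF C] by blast
  have finC: "finite C" using component_subset[OF C] fin by (rule finite_subset)
  define dst where "dst v = (LEAST k. (r, v) \<in> adj A ^^ k)" for v
  have "\<exists>u. {u, v} \<in> A \<and> dst u < dst v" if v: "v \<in> C - {r}" for v
  proof -
    have "\<exists>k. (r, v) \<in> adj A ^^ k"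
      using v component_eq[OF C r] by (auto simp: rtrancl_power)
    then have dv: "(r, v) \<in> adj A ^^ dst v" unfolding dst_def by (rule LeastI_ex)
    moreover have "dst v \<noteq> 0" using dv v by (metis DiffD2 relpow_0_E singletonI)
    ultimately obtain k where k: "dst v = Suc k" "(r, v) \<in> adj A ^^ Suc k"
      by (metis not0_implies_Suc)
    then obtain u where u: "(r, u) \<in> adj A ^^ k" "(u, v) \<in> adj A" by (auto elim: relpow_Suc_E)
    have "dst u \<le> k" unfolding dst_def using u(1) by (rule Least_le)
    with u k show ?thesis by (auto simp: adj_def)
  qed
  then obtain parent where parent:
    "\<And>v. v \<in> C - {r} \<Longrightarrow> {parent v, v} \<in> A \<and> dst (parent v) < dst v"
    by metis
  have "inj_on (\<lambda>v. {parent v, v}) (C - {r})"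
  proof (rule inj_onI)
    fix u v assume uv: "u \<in> C - {r}" "v \<in> C - {r}" "{parent u, u} = {parent v, v}"
    show "u = v"
    proof (rule ccontr)
      assume "u \<noteq> v"
      with uv(3) have "parent u = v" "parent v = u" by (auto simp: doubleton_eq_iff)
      with parent[OF uv(1)] parent[OF uv(2)] show False by simp
    qed
  qed
  moreover have "(\<lambda>v. {parent v, v}) ` (C - {r}) \<subseteq> {e \<in> A. e \<subseteq> C}"
  proof clarify
    fix v assume v: "v \<in> C" "v \<noteq> r"
    then have "{parent v, v} \<in> A" using parent by blast
    with edge_in_component[OF A C this] v
    show "{parent v, v} \<in> A \<and> {parent v, v} \<subseteq> C" by auto
  qed
  moreover have "finite A" using A fin by (auto intro: finite_subset[of A "Pow V"])
  ultimately have "card (C - {r}) \<le> card {e \<in> A. e \<subseteq> C}"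
    by (intro card_inj_on_le) auto
  then show ?thesis using r finC by (simp add: card_Diff_singleton)
qed

lemma component_subset_nbhd:
  assumes fin: "finite V" and A: "A \<subseteq> {e. e \<subseteq> V \<and> card e = 2}" and C: "C \<in> components V A"
    and sub: "V \<subseteq> verts g" "A \<subseteq> edges g" and v: "v \<in> C" and r: "(card C)\<^sup>2 \<le> r"
  shows "C \<subseteq> verts (nbhd g r v)"
proof
  fix u assume u: "u \<in> C"
  define R where "R = adj A \<inter> C \<times> C"
  have finC: "finite C" using component_subset[OF C] fin by (rule finite_subset)
  have "(v, u) \<in> (adj A)\<^sup>*" using u component_eq[OF C v] by simp
  then have "(v, u) \<in> R\<^sup>* \<and> u \<in> C"
  proof (induction rule: rtrancl_induct)
    case base
    then show ?case using v by simp
  next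
    case (step y z)
    then have "{y, z} \<in> A" by (simp add: adj_def)
    then have "z \<in> C" using edge_in_component[OF A C, of "{y, z}"] step.IH by blast
    then have "(y, z) \<in> R" using step by (simp add: R_def)
    then show ?case using \<open>z \<in> C\<close> step.IH by auto
  qed
  moreover have finR: "finite R" using finC by (simp add: R_def)
  ultimately obtain k where k: "k \<le> card R" "(v, u) \<in> R ^^ k"
    using rtrancl_finite_eq_relpow[OF finR] by auto
  have "card R \<le> card (C \<times> C)" unfolding R_def using finC by (intro card_mono) auto
  then have "k \<le> r" using k r by (simp add: card_cartesian_product power2_eq_square)
  moreover have "R \<subseteq> adj (edges g)" using sub by (auto simp: R_def adj_def)
  then have "R ^^ k \<subseteq> adj (edges g) ^^ k" by (induction k) (auto simp: relcomp_mono)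
  then have "(v, u) \<in> adj (edges g) ^^ k" using k by blast
  moreover have "u \<in> verts g" using u component_subset[OF C] sub by blast
  ultimately show "u \<in> verts (nbhd g r v)" by (auto simp: nbhd_def Let_def)
qed

text \<open>A component that is not a tree is large or contains a vertex whose neighbourhood is not a
  tree. The radius \<open>m\<^sup>2\<close> is a crude bound for the diameter of a component of fewer than
  \<open>m\<close> vertices.\<close>

lemma card_nontree_components_le:
  assumes g: "finite_simple_graph g" and A: "A \<subseteq> edges g" and m: "m > 0"
  shows "real (card {C \<in> components (verts g) A. card C \<le> card {e \<in> A. e \<subseteq> C}})
    \<le> real (card {v \<in> verts g. \<not> is_tree (nbhd g (m\<^sup>2) v)}) + real (card (verts g)) / real m"
proof -
  define V where "V = verts g"
  define bad where "bad = {v \<in> V. \<not> is_tree (nbhd g (m\<^sup>2) v)}"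
  define large where "large = {C \<in> components V A. m \<le> card C}"
  define cls where "cls v = {u \<in> V. (v, u) \<in> (adj A)\<^sup>*}" for v
  have fin: "finite V" and A2: "A \<subseteq> {e. e \<subseteq> V \<and> card e = 2}"
    using g A by (auto simp: finite_simple_graph_def V_def)
  have "C \<in> cls ` bad \<union> large" if C: "C \<in> components V A" "card C \<le> card {e \<in> A. e \<subseteq> C}" for C
  proof (cases "m \<le> card C")
    case True
    then show ?thesis using C by (simp add: large_def)
  next
    case False
    obtain v where v: "v \<in> C" using component_nonempty[OF C(1)] by blast
    have finC: "finite C" using component_subset[OF C(1)] fin by (rule finite_subset)
    have sub: "C \<subseteq> verts (nbhd g (m\<^sup>2) v)"
      by (rule component_subset_nbhd[OF fin A2 C(1) _ A v])
         (use False in \<open>auto simp: V_def power_mono\<close>)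
    obtain c where "is_cycle \<lparr>verts = C, edges = {e \<in> A. e \<subseteq> C}\<rparr> c"
      using many_edges_imp_cycle[OF finC _ _ C(2)] A2 component_nonempty[OF C(1)] by auto
    then have "is_cycle (nbhd g (m\<^sup>2) v) c"
      by (rule is_cycle_mono) (use sub A in \<open>auto simp: nbhd_def Let_def\<close>)
    then have "v \<in> bad"
      using v component_subset[OF C(1)] by (auto simp: bad_def is_tree_def)
    moreover have "C = cls v" unfolding cls_def by (rule component_eq[OF C(1) v])
    ultimately show ?thesis by blast
  qed
  then have "card {C \<in> components V A. card C \<le> card {e \<in> A. e \<subseteq> C}} \<le> card (cls ` bad \<union> large)"
    using fin finite_components[OF fin, of A] by (intro card_mono) (auto simp: bad_def large_def)
  also have "\<dots> \<le> card bad + card large"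
    using card_Un_le[of "cls ` bad" large] card_image_le[of bad cls] fin by (simp add: bad_def)
  finally have le: "card {C \<in> components V A. card C \<le> card {e \<in> A. e \<subseteq> C}} \<le> card bad + card large" .
  have "m * card large \<le> (\<Sum>C\<in>large. card C)"
    using sum_bounded_below[of large m card] by (simp add: large_def mult.commute)
  also have "\<dots> = card (\<Union> large)"
  proof (rule card_Union_disjoint[symmetric])
    show "pairwise disjnt large"
      using components_disjoint unfolding large_def pairwise_def disjnt_def by blast
    show "finite C" if "C \<in> large" for C
      using that component_subset[of C V A] fin by (auto simp: large_def intro: finite_subset)
  qed
  also have "\<dots> \<le> card V"
    using component_subset[of _ V A] fin by (intro card_mono) (auto simp: large_def)
  finally have "real m * real (card large) \<le> real (card V)" by (metis of_nat_le_iff of_nat_mult)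
  then have "real (card large) \<le> real (card V) / real m" using m by (simp add: field_simps)
  moreover have "real (card {C \<in> components V A. card C \<le> card {e \<in> A. e \<subseteq> C}})
    \<le> real (card bad) + real (card large)" using le by linarith
  ultimately show ?thesis unfolding V_def bad_def by linarith
qed


section \<open>The rank-two approximation\<close>

text \<open>The random cluster sum in which the weight \<open>(q - 1) * exp (- B * card C)\<close> of a component
  \<open>C\<close> with \<open>k\<close> edges is replaced by \<open>(q - 1) ^ (card C - k) * exp (- B * card C)\<close>. Both weights
  agree for a tree. The exponent \<open>card C - k\<close> can be negative, so a quotient is used.\<close>

definition Z_rank2 :: "'v graph \<Rightarrow> real \<Rightarrow> real \<Rightarrow> real \<Rightarrow> real" where
  "Z_rank2 g q w B =
     (\<Sum>A \<in> Pow (edges g). w ^ card A *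
        (\<Prod>C\<in>components (verts g) A.
           1 + (exp (- B) * (q - 1)) ^ card C / (q - 1) ^ card {e \<in> A. e \<subseteq> C}))"

lemma sum_PiE_two_values:
  assumes "a \<noteq> b"
  shows "(\<Sum>\<sigma> \<in> V \<rightarrow>\<^sub>E {a, b}. F \<sigma>) = (\<Sum>S\<in>Pow V. F (\<lambda>v\<in>V. if v \<in> S then a else b))"
proof (rule sum.reindex_bij_witness[where i = "\<lambda>S. \<lambda>v\<in>V. if v \<in> S then a else b"
      and j = "\<lambda>\<sigma>. {v \<in> V. \<sigma> v = a}"])
  fix \<sigma> assume \<sigma>: "\<sigma> \<in> V \<rightarrow>\<^sub>E {a, b}"
  show "(\<lambda>v\<in>V. if v \<in> {v \<in> V. \<sigma> v = a} then a else b) = \<sigma>"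
  proof
    fix v show "(\<lambda>v\<in>V. if v \<in> {v \<in> V. \<sigma> v = a} then a else b) v = \<sigma> v"
      using PiE_mem[OF \<sigma>, of v] PiE_arb[OF \<sigma>, of v] by (cases "v \<in> V") auto
  qed
  then show "F (\<lambda>v\<in>V. if v \<in> {v \<in> V. \<sigma> v = a} then a else b) = F \<sigma>" by simp
qed (use assms in auto)

lemma Z_RC_eq_sum_Pow:
  assumes "finite (edges g)"
  shows "Z_RC g q w B = (\<Sum>A\<in>Pow (edges g). w ^ card A *
     (\<Prod>C\<in>components (verts g) A. 1 + (q - 1) * exp (- B * real (card C))))"
proof -
  have "Z_RC g q w B = (\<Sum>A\<in>Pow (edges g).
      (\<Prod>e\<in>edges g. w ^ (\<lambda>e\<in>edges g. if e \<in> A then 1 else 0) e) *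
      (\<Prod>C\<in>components (verts g) {e \<in> edges g. (\<lambda>e\<in>edges g. if e \<in> A then 1 else 0::nat) e = 1}.
         1 + (q - 1) * exp (- B * real (card C))))"
    unfolding Z_RC_def insert_commute[of 0 1] by (rule sum_PiE_two_values) simp
  also have "\<dots> = (\<Sum>A\<in>Pow (edges g). w ^ card A *
     (\<Prod>C\<in>components (verts g) A. 1 + (q - 1) * exp (- B * real (card C))))"
  proof (rule sum.cong[OF refl])
    fix A assume A: "A \<in> Pow (edges g)"
    have "(\<Prod>e\<in>edges g. w ^ (\<lambda>e\<in>edges g. if e \<in> A then 1 else 0) e) = (\<Prod>e\<in>edges g. if e \<in> A then w else 1)"
      by (intro prod.cong) auto
    also have "\<dots> = (\<Prod>e\<in>A. w)"
      using A assms by (simp add: prod.If_cases Int_absorb1)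
    finally have 1: "(\<Prod>e\<in>edges g. w ^ (\<lambda>e\<in>edges g. if e \<in> A then 1 else 0) e) = w ^ card A"
      by simp
    have 2: "{e \<in> edges g. (\<lambda>e\<in>edges g. if e \<in> A then 1 else 0::nat) e = 1} = A" using A by auto
    show "(\<Prod>e\<in>edges g. w ^ (\<lambda>e\<in>edges g. if e \<in> A then 1 else 0) e) *
      (\<Prod>C\<in>components (verts g) {e \<in> edges g. (\<lambda>e\<in>edges g. if e \<in> A then 1 else 0::nat) e = 1}.
         1 + (q - 1) * exp (- B * real (card C))) = w ^ card A *
     (\<Prod>C\<in>components (verts g) A. 1 + (q - 1) * exp (- B * real (card C)))"
      unfolding 1 2 ..
  qed
  finally show ?thesis .
qed

lemma card_Union_components:
  assumes "finite V" "X \<subseteq> components V A"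
  shows "card (\<Union> X) = (\<Sum>C\<in>X. card C)"
proof (rule card_Union_disjoint)
  show "pairwise disjnt X"
    using components_disjoint assms(2) unfolding pairwise_def disjnt_def by blast
  show "finite C" if "C \<in> X" for C
    using that assms component_subset[of C V A] by (auto intro: finite_subset)
qed

lemma card_edges_Union_components:
  assumes fin: "finite V" and A: "A \<subseteq> {e. e \<subseteq> V \<and> card e = 2}" and X: "X \<subseteq> components V A"
  shows "card {e \<in> A. e \<subseteq> \<Union> X} = (\<Sum>C\<in>X. card {e \<in> A. e \<subseteq> C})"
proof -
  have finA: "finite A" using A fin by (auto intro: finite_subset[of A "Pow V"])
  have ne: "e \<noteq> {}" if "e \<in> A" for e using that A by auto
  have "{e \<in> A. e \<subseteq> \<Union> X} = (\<Union>C\<in>X. {e \<in> A. e \<subseteq> C})"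
  proof (intro equalityI subsetI)
    fix e assume e: "e \<in> {e \<in> A. e \<subseteq> \<Union> X}"
    then obtain C where "C \<in> X" "e \<inter> C \<noteq> {}" using ne[of e] by blast
    then show "e \<in> (\<Union>C\<in>X. {e \<in> A. e \<subseteq> C})"
      using edge_in_component[OF A, of C e] X e by blast
  qed auto
  also have "card \<dots> = (\<Sum>C\<in>X. card {e \<in> A. e \<subseteq> C})"
  proof (rule card_UN_disjoint)
    show "finite X" using X finite_components[OF fin] by (rule finite_subset)
    show "\<forall>C\<in>X. finite {e \<in> A. e \<subseteq> C}" using finA by simp
    show "\<forall>C\<in>X. \<forall>D\<in>X. C \<noteq> D \<longrightarrow> {e \<in> A. e \<subseteq> C} \<inter> {e \<in> A. e \<subseteq> D} = {}"
    proof (intro ballI impI)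
      fix C D assume "C \<in> X" "D \<in> X" "C \<noteq> D"
      then have "C \<inter> D = {}" using components_disjoint[of C V A D] X by blast
      then show "{e \<in> A. e \<subseteq> C} \<inter> {e \<in> A. e \<subseteq> D} = {}" using ne by blast
    qed
  qed
  finally show ?thesis .
qed

lemma Union_components_eq:
  assumes X: "X \<subseteq> components V A"
  shows "{C \<in> components V A. C \<subseteq> \<Union> X} = X"
proof (intro equalityI subsetI)
  fix C assume C: "C \<in> {C \<in> components V A. C \<subseteq> \<Union> X}"
  then obtain x D where "x \<in> C" "x \<in> D" "D \<in> X" using component_nonempty[of C V A] by blast
  then show "C \<in> X" using components_disjoint[of C V A D] C X by blast
qed (use X in auto)

lemma closed_set_eq_Union_components:
  assumes "S \<subseteq> V" and closed: "\<And>e. e \<in> A \<Longrightarrow> e \<subseteq> S \<or> e \<inter> S = {}"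
  shows "\<Union> {C \<in> components V A. C \<subseteq> S} = S"
proof (intro equalityI subsetI)
  fix v assume v: "v \<in> S"
  then obtain C where C: "C \<in> components V A" "v \<in> C" using assms(1) Union_graph_components[of V A] by blast
  have "u \<in> S" if "(v, u) \<in> (adj A)\<^sup>*" for u
    using that
  proof (induction rule: rtrancl_induct)
    case (step y z)
    then show ?case using closed[of "{y, z}"] by (auto simp: adj_def)
  qed (rule v)
  then have "C \<subseteq> S" using component_eq[OF C] by blast
  then show "v \<in> \<Union> {C \<in> components V A. C \<subseteq> S}" using C by blast
qed auto

text \<open>Every component receives one of two colours, and \<open>S\<close> is the set of vertices of the second
  colour. A colouring \<open>S\<close> contributes only if no edge of \<open>A\<close> joins \<open>S\<close> to its complement.\<close>

lemma prod_components_eq_sum_colourings: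
  fixes s t w :: real
  assumes fin: "finite V" and A: "A \<subseteq> {e. e \<subseteq> V \<and> card e = 2}"
  shows "w ^ card A * (\<Prod>C\<in>components V A. 1 + t ^ card C / s ^ card {e \<in> A. e \<subseteq> C})
    = (\<Sum>S\<in>Pow V. t ^ card S *
        (\<Prod>e\<in>A. if e \<subseteq> S then w / s else if e \<inter> S = {} then w else 0))"
proof -
  define f where "f C = t ^ card C / s ^ card {e \<in> A. e \<subseteq> C}" for C
  define h where "h S = t ^ card S *
    (\<Prod>e\<in>A. if e \<subseteq> S then w / s else if e \<inter> S = {} then w else 0)" for S
  have finA: "finite A" using A fin by (auto intro: finite_subset[of A "Pow V"])
  have finc: "finite (components V A)" using fin by (rule finite_components)
  have h: "h (\<Union> X) = w ^ card A * (\<Prod>C\<in>X. f C)" if X: "X \<subseteq> components V A" for X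
  proof -
    have "(\<Prod>e\<in>A. if e \<subseteq> \<Union> X then w / s else if e \<inter> \<Union> X = {} then w else 0)
      = (\<Prod>e\<in>A. w * (if e \<subseteq> \<Union> X then 1 / s else 1))"
    proof (rule prod.cong[OF refl])
      fix e assume e: "e \<in> A"
      have "e \<subseteq> \<Union> X" if "e \<inter> \<Union> X \<noteq> {}"
        using that edge_in_component[OF A _ e] X by blast
      then show "(if e \<subseteq> \<Union> X then w / s else if e \<inter> \<Union> X = {} then w else 0)
        = w * (if e \<subseteq> \<Union> X then 1 / s else 1)" by auto
    qed
    also have "\<dots> = w ^ card A * (1 / s) ^ card {e \<in> A. e \<subseteq> \<Union> X}"
      using finA by (simp add: prod.distrib prod.If_cases Int_def)
    finally show ?thesis
      unfolding h_def f_def card_Union_components[OF fin X] card_edges_Union_components[OF fin A X]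
      by (simp add: power_sum prod_dividef power_one_over)
  qed
  have "w ^ card A * (\<Prod>C\<in>components V A. 1 + f C)
      = w ^ card A * (\<Sum>X\<in>Pow (components V A). \<Prod>C\<in>X. f C)"
    using prod_add[OF finc, of f "\<lambda>_. 1"] by (simp add: add.commute)
  also have "\<dots> = (\<Sum>X\<in>Pow (components V A). h (\<Union> X))"
    using h by (simp add: sum_distrib_left)
  also have "\<dots> = (\<Sum>S\<in>{S. S \<subseteq> V \<and> (\<forall>e\<in>A. e \<subseteq> S \<or> e \<inter> S = {})}. h S)"
  proof (rule sum.reindex_bij_witness[where i = "\<lambda>S. {C \<in> components V A. C \<subseteq> S}" and j = Union])
    fix X assume X: "X \<in> Pow (components V A)"
    show "{C \<in> components V A. C \<subseteq> \<Union> X} = X" using Union_components_eq X by blast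
    show "\<Union> X \<in> {S. S \<subseteq> V \<and> (\<forall>e\<in>A. e \<subseteq> S \<or> e \<inter> S = {})}"
    proof (intro CollectI conjI ballI)
      show "\<Union> X \<subseteq> V" using X component_subset[of _ V A] by blast
      show "e \<subseteq> \<Union> X \<or> e \<inter> \<Union> X = {}" if "e \<in> A" for e
        using edge_in_component[OF A _ that] X by blast
    qed
  next
    fix S assume "S \<in> {S. S \<subseteq> V \<and> (\<forall>e\<in>A. e \<subseteq> S \<or> e \<inter> S = {})}"
    then show "\<Union> {C \<in> components V A. C \<subseteq> S} = S"
      by (intro closed_set_eq_Union_components) auto
  qed auto
  also have "\<dots> = (\<Sum>S\<in>Pow V. h S)"
  proof (rule sum.mono_neutral_left)
    show "\<forall>S\<in>Pow V - {S. S \<subseteq> V \<and> (\<forall>e\<in>A. e \<subseteq> S \<or> e \<inter> S = {})}. h S = 0"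
      using finA by (auto simp: h_def prod_zero_iff)
  qed (use fin in auto)
  finally show ?thesis unfolding f_def h_def .
qed

text \<open>With the colouring \<open>S\<close> fixed, summing over \<open>A\<close> expands a product over the edges.\<close>

lemma sum_subgraphs_eq_sum_colourings:
  fixes s t w :: real
  assumes fin: "finite V" and E: "E \<subseteq> {e. e \<subseteq> V \<and> card e = 2}"
  shows "(\<Sum>A\<in>Pow E. w ^ card A *
      (\<Prod>C\<in>components V A. 1 + t ^ card C / s ^ card {e \<in> A. e \<subseteq> C}))
    = (\<Sum>S\<in>Pow V. t ^ card S *
        (\<Prod>e\<in>E. if e \<subseteq> S then 1 + w / s else if e \<inter> S = {} then 1 + w else 1))"
proof -
  define y where "y S e = (if e \<subseteq> S then w / s else if e \<inter> S = {} then w else 0)" for S e :: "'a set"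
  have finE: "finite E" using E fin by (auto intro: finite_subset[of E "Pow V"])
  have "(\<Sum>A\<in>Pow E. w ^ card A *
      (\<Prod>C\<in>components V A. 1 + t ^ card C / s ^ card {e \<in> A. e \<subseteq> C}))
    = (\<Sum>A\<in>Pow E. \<Sum>S\<in>Pow V. t ^ card S * (\<Prod>e\<in>A. y S e))"
    unfolding y_def using E by (intro sum.cong refl prod_components_eq_sum_colourings fin) auto
  also have "\<dots> = (\<Sum>S\<in>Pow V. t ^ card S * (\<Sum>A\<in>Pow E. \<Prod>e\<in>A. y S e))"
    by (subst sum.swap) (simp add: sum_distrib_left)
  also have "\<dots> = (\<Sum>S\<in>Pow V. t ^ card S * (\<Prod>e\<in>E. y S e + 1))"
    by (simp add: prod_add[OF finE])
  also have "\<dots> = (\<Sum>S\<in>Pow V. t ^ card S *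
        (\<Prod>e\<in>E. if e \<subseteq> S then 1 + w / s else if e \<inter> S = {} then 1 + w else 1))"
    unfolding y_def by (intro sum.cong refl arg_cong2[where f = times] prod.cong) auto
  finally show ?thesis .
qed

section \<open>Reduction to the Ising model\<close>

lemma finite_edges: "finite_simple_graph g \<Longrightarrow> finite (edges g)"
  unfolding finite_simple_graph_def by (auto intro: finite_subset[of _ "Pow (verts g)"])

lemma sum_edges_sum_ends:
  fixes f :: "'v \<Rightarrow> real"
  assumes g: "finite_simple_graph g" "regular_graph d g"
  shows "(\<Sum>e\<in>edges g. \<Sum>v\<in>e. f v) = real d * (\<Sum>v\<in>verts g. f v)"
proof -
  have fin: "finite (verts g)" using g by (simp add: finite_simple_graph_def)
  have "(\<Sum>e\<in>edges g. \<Sum>v\<in>e. f v) = (\<Sum>e\<in>edges g. sum f {v \<in> verts g. v \<in> e})"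
    using g by (intro sum.cong refl arg_cong2[where f = sum]) (auto simp: finite_simple_graph_def)
  also have "\<dots> = (\<Sum>v\<in>verts g. \<Sum>e\<in>{e \<in> edges g. v \<in> e}. f v)"
    by (rule sum.swap_restrict[OF finite_edges[OF g(1)] fin])
  also have "\<dots> = (\<Sum>v\<in>verts g. real d * f v)"
    using g by (intro sum.cong refl) (auto simp: regular_graph_def)
  finally show ?thesis by (simp add: sum_distrib_left)
qed

lemma card_edges_regular:
  assumes g: "finite_simple_graph g" "regular_graph d g"
  shows "2 * real (card (edges g)) = real d * real (card (verts g))"
proof -
  have "(\<Sum>e\<in>edges g. \<Sum>v\<in>e. 1) = (\<Sum>e\<in>edges g. 2 :: real)"
    using g by (intro sum.cong) (auto simp: finite_simple_graph_def)
  then show ?thesis using sum_edges_sum_ends[OF g, of "\<lambda>_. 1"] by simp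
qed

text \<open>The edge weights \<open>exp \<beta>\<close>, \<open>1\<close> and \<open>exp \<gamma>\<close> for the spin pairs \<open>++\<close>, \<open>+-\<close> and \<open>--\<close> have
  the form \<open>exp (b + b * \<sigma> u * \<sigma> v + h * (\<sigma> u + \<sigma> v))\<close> with \<open>b = (\<beta> + \<gamma>) / 4\<close> and
  \<open>h = (\<beta> - \<gamma>) / 4\<close>. By regularity, the terms with \<open>h\<close> add up to a homogeneous field.\<close>

lemma sum_colourings_eq_Z_Ising:
  fixes t \<beta> \<gamma> :: real
  assumes g: "finite_simple_graph g" "regular_graph d g" and t: "t > 0"
  shows "(\<Sum>S\<in>Pow (verts g). t ^ card S *
      (\<Prod>e\<in>edges g. if e \<subseteq> S then exp \<gamma> else if e \<inter> S = {} then exp \<beta> else 1))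
    = exp (real (card (verts g)) * ((\<beta> + \<gamma>) / 4 * real d / 2 + ln t / 2)) *
      Z_Ising g ((\<beta> + \<gamma>) / 4) (real d * (\<beta> - \<gamma>) / 4 - ln t / 2)"
proof -
  define b where "b = (\<beta> + \<gamma>) / 4"
  define h where "h = (\<beta> - \<gamma>) / 4"
  define \<sigma> where "\<sigma> S v = (if v \<in> S then -1 else 1 :: real)" for S and v :: 'a
  have fin: "finite (verts g)" and E: "\<And>e. e \<in> edges g \<Longrightarrow> e \<subseteq> verts g \<and> card e = 2"
    using g by (auto simp: finite_simple_graph_def)
  have finE: "finite (edges g)" using finite_edges g by blast
  have "Z_Ising g b (real d * h - ln t / 2) = (\<Sum>S\<in>Pow (verts g).
      exp (b * (\<Sum>e\<in>edges g. \<Prod>v\<in>e. (\<lambda>v\<in>verts g. \<sigma> S v) v) +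
        (real d * h - ln t / 2) * (\<Sum>v\<in>verts g. (\<lambda>v\<in>verts g. \<sigma> S v) v)))"
    unfolding Z_Ising_def \<sigma>_def by (rule sum_PiE_two_values) simp
  also have "\<dots> = (\<Sum>S\<in>Pow (verts g).
      exp (b * (\<Sum>e\<in>edges g. \<Prod>v\<in>e. \<sigma> S v) + (real d * h - ln t / 2) * (\<Sum>v\<in>verts g. \<sigma> S v)))"
  proof (rule sum.cong[OF refl])
    fix S
    have "(\<Sum>e\<in>edges g. \<Prod>v\<in>e. (\<lambda>v\<in>verts g. \<sigma> S v) v) = (\<Sum>e\<in>edges g. \<Prod>v\<in>e. \<sigma> S v)"
      using E by (intro sum.cong prod.cong refl) auto
    then show "exp (b * (\<Sum>e\<in>edges g. \<Prod>v\<in>e. (\<lambda>v\<in>verts g. \<sigma> S v) v) +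
        (real d * h - ln t / 2) * (\<Sum>v\<in>verts g. (\<lambda>v\<in>verts g. \<sigma> S v) v))
      = exp (b * (\<Sum>e\<in>edges g. \<Prod>v\<in>e. \<sigma> S v) + (real d * h - ln t / 2) * (\<Sum>v\<in>verts g. \<sigma> S v))"
      by simp
  qed
  finally have Z: "Z_Ising g b (real d * h - ln t / 2) = (\<Sum>S\<in>Pow (verts g).
      exp (b * (\<Sum>e\<in>edges g. \<Prod>v\<in>e. \<sigma> S v) + (real d * h - ln t / 2) * (\<Sum>v\<in>verts g. \<sigma> S v)))" .
  have "t ^ card S * (\<Prod>e\<in>edges g. if e \<subseteq> S then exp \<gamma> else if e \<inter> S = {} then exp \<beta> else 1)
    = exp (real (card (verts g)) * (b * real d / 2 + ln t / 2)) *
      exp (b * (\<Sum>e\<in>edges g. \<Prod>v\<in>e. \<sigma> S v) + (real d * h - ln t / 2) * (\<Sum>v\<in>verts g. \<sigma> S v))"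
    if S: "S \<in> Pow (verts g)" for S
  proof -
    have "(\<Prod>e\<in>edges g. if e \<subseteq> S then exp \<gamma> else if e \<inter> S = {} then exp \<beta> else 1)
      = (\<Prod>e\<in>edges g. exp (b + b * (\<Prod>v\<in>e. \<sigma> S v) + h * (\<Sum>v\<in>e. \<sigma> S v)))"
    proof (rule prod.cong[OF refl])
      fix e assume "e \<in> edges g"
      then have "card e = 2" using E by blast
      then obtain u v where "e = {u, v}" "u \<noteq> v" by (auto simp: card_2_iff)
      then show "(if e \<subseteq> S then exp \<gamma> else if e \<inter> S = {} then exp \<beta> else 1)
        = exp (b + b * (\<Prod>v\<in>e. \<sigma> S v) + h * (\<Sum>v\<in>e. \<sigma> S v))"
        by (auto simp: \<sigma>_def b_def h_def field_simps)
    qed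
    also have "\<dots> = exp (b * real (card (edges g)) + b * (\<Sum>e\<in>edges g. \<Prod>v\<in>e. \<sigma> S v)
        + h * (\<Sum>e\<in>edges g. \<Sum>v\<in>e. \<sigma> S v))"
      by (simp add: exp_sum[OF finE, symmetric] sum.distrib sum_distrib_left)
    also have "(\<Sum>e\<in>edges g. \<Sum>v\<in>e. \<sigma> S v) = real d * (\<Sum>v\<in>verts g. \<sigma> S v)"
      by (rule sum_edges_sum_ends[OF g])
    also have "real (card (edges g)) = real d * real (card (verts g)) / 2"
      using card_edges_regular[OF g] by simp
    finally have P: "(\<Prod>e\<in>edges g. if e \<subseteq> S then exp \<gamma> else if e \<inter> S = {} then exp \<beta> else 1)
      = exp (b * (real d * real (card (verts g)) / 2) + b * (\<Sum>e\<in>edges g. \<Prod>v\<in>e. \<sigma> S v)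
        + h * (real d * (\<Sum>v\<in>verts g. \<sigma> S v)))" .
    have "(\<Sum>v\<in>verts g. \<sigma> S v) = (\<Sum>v\<in>verts g. 1 - 2 * (if v \<in> S then 1 else 0))"
      by (intro sum.cong) (auto simp: \<sigma>_def)
    also have "\<dots> = real (card (verts g)) - 2 * real (card S)"
      using S fin by (simp add: sum_subtractf sum_distrib_left[symmetric] sum.If_cases Int_absorb1)
    finally have c: "real (card S) = (real (card (verts g)) - (\<Sum>v\<in>verts g. \<sigma> S v)) / 2" by simp
    have "t ^ card S = exp (real (card S) * ln t)" using t by (simp add: exp_of_nat_mult)
    then show ?thesis unfolding P c by (simp add: exp_add[symmetric] field_simps)
  qed
  then have "(\<Sum>S\<in>Pow (verts g). t ^ card S *
      (\<Prod>e\<in>edges g. if e \<subseteq> S then exp \<gamma> else if e \<inter> S = {} then exp \<beta> else 1))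
    = exp (real (card (verts g)) * (b * real d / 2 + ln t / 2)) * Z_Ising g b (real d * h - ln t / 2)"
    unfolding Z sum_distrib_left by (intro sum.cong refl)
  then show ?thesis by (simp add: b_def h_def)
qed

lemma Z_Ising_pos:
  assumes "finite_simple_graph g"
  shows "Z_Ising g \<beta> B > 0"
proof -
  have "finite (verts g \<rightarrow>\<^sub>E {-1, 1 :: real})"
    using assms by (intro finite_PiE) (auto simp: finite_simple_graph_def)
  moreover have "verts g \<rightarrow>\<^sub>E {-1, 1 :: real} \<noteq> {}" by (simp add: PiE_eq_empty_iff)
  ultimately show ?thesis unfolding Z_Ising_def by (intro sum_pos) auto
qed

lemma Z_rank2_eq_Z_Ising:
  assumes g: "finite_simple_graph g" "regular_graph d g" and q: "q > 1"
    and \<beta>: "exp \<beta> = 1 + w" and \<gamma>: "exp \<gamma> = 1 + w / (q - 1)"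
  shows "Z_rank2 g q w B
    = exp (real (card (verts g)) * ((\<beta> + \<gamma>) / 4 * real d / 2 + ln (exp (- B) * (q - 1)) / 2)) *
      Z_Ising g ((\<beta> + \<gamma>) / 4) (real d * (\<beta> - \<gamma>) / 4 - ln (exp (- B) * (q - 1)) / 2)"
proof -
  have fin: "finite (verts g)" and E: "edges g \<subseteq> {e. e \<subseteq> verts g \<and> card e = 2}"
    using g by (auto simp: finite_simple_graph_def)
  show ?thesis
    unfolding Z_rank2_def sum_subgraphs_eq_sum_colourings[OF fin E] \<beta>[symmetric] \<gamma>[symmetric]
    by (rule sum_colourings_eq_Z_Ising[OF g]) (use q in simp)
qed

section \<open>Comparison with the random cluster model\<close>

lemma Z_rank2_le_Z_RC:
  assumes g: "finite_simple_graph g" and q: "q \<ge> 2" and w: "w \<ge> 0"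
  shows "Z_rank2 g q w B \<le> Z_RC g q w B"
  unfolding Z_rank2_def Z_RC_eq_sum_Pow[OF finite_edges[OF g]]
proof (intro sum_mono mult_left_mono prod_mono conjI)
  fix A C assume A: "A \<in> Pow (edges g)" and C: "C \<in> components (verts g) A"
  show "0 \<le> 1 + (exp (- B) * (q - 1)) ^ card C / (q - 1) ^ card {e \<in> A. e \<subseteq> C}"
    using q by (intro add_nonneg_nonneg divide_nonneg_nonneg zero_le_power) auto
  have "card C \<le> Suc (card {e \<in> A. e \<subseteq> C})"
    by (rule card_component_le[OF _ _ C]) (use g A in \<open>auto simp: finite_simple_graph_def\<close>)
  then have "(q - 1) ^ card C \<le> (q - 1) ^ Suc (card {e \<in> A. e \<subseteq> C})"
    using q by (intro power_increasing) auto
  then have "(q - 1) ^ card C / (q - 1) ^ card {e \<in> A. e \<subseteq> C} \<le> q - 1"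
    using q by (simp add: divide_le_eq)
  then have "exp (- B * real (card C)) * ((q - 1) ^ card C / (q - 1) ^ card {e \<in> A. e \<subseteq> C})
    \<le> exp (- B * real (card C)) * (q - 1)" by (intro mult_left_mono) auto
  then show "1 + (exp (- B) * (q - 1)) ^ card C / (q - 1) ^ card {e \<in> A. e \<subseteq> C}
    \<le> 1 + (q - 1) * exp (- B * real (card C))"
    by (simp add: power_mult_distrib exp_of_nat2_mult[symmetric] mult.commute)
qed (use w in simp)

lemma Z_RC_le_Z_rank2:
  assumes g: "finite_simple_graph g" and q: "q \<ge> 2" and w: "w \<ge> 0" and B: "B \<ge> 0" and m: "m > 0"
  shows "Z_RC g q w B \<le> q powr (real (card {v \<in> verts g. \<not> is_tree (nbhd g (m\<^sup>2) v)})
      + real (card (verts g)) / real m) * Z_rank2 g q w B" (is "_ \<le> q powr ?N * _")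
  unfolding Z_rank2_def Z_RC_eq_sum_Pow[OF finite_edges[OF g]] sum_distrib_left
proof (rule sum_mono)
  fix A assume A: "A \<in> Pow (edges g)"
  define K where "K = components (verts g) A"
  define f where "f C = (exp (- B) * (q - 1)) ^ card C / (q - 1) ^ card {e \<in> A. e \<subseteq> C}" for C
  define L where "L = {C \<in> K. card C \<le> card {e \<in> A. e \<subseteq> C}}"
  have fin: "finite (verts g)" and A2: "A \<subseteq> {e. e \<subseteq> verts g \<and> card e = 2}"
    using g A by (auto simp: finite_simple_graph_def)
  have LK: "L \<subseteq> K" by (auto simp: L_def)
  have finK: "finite K" unfolding K_def using fin by (rule finite_components)
  have f0: "f C \<ge> 0" for C
    unfolding f_def using q by (intro divide_nonneg_nonneg zero_le_power) auto
  have le: "1 + (q - 1) * exp (- B * real (card C)) \<le> (if C \<in> L then q else 1) * (1 + f C)"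
    if C: "C \<in> K" for C
  proof (cases "C \<in> L")
    case True
    have "exp (- B * real (card C)) \<le> 1" using B by simp
    then have "(q - 1) * exp (- B * real (card C)) \<le> (q - 1) * 1"
      using q by (intro mult_left_mono) auto
    then have "1 + (q - 1) * exp (- B * real (card C)) \<le> q * 1" by simp
    also have "\<dots> \<le> q * (1 + f C)" using f0 q by (intro mult_left_mono) auto
    finally show ?thesis using True by simp
  next
    case False
    then have "card C = Suc (card {e \<in> A. e \<subseteq> C})"
      using card_component_le[OF fin A2] C by (fastforce simp: L_def K_def)
    then have "(q - 1) ^ card C / (q - 1) ^ card {e \<in> A. e \<subseteq> C} = q - 1" using q by simp
    moreover have "f C = exp (- B * real (card C)) *
        ((q - 1) ^ card C / (q - 1) ^ card {e \<in> A. e \<subseteq> C})"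
      by (simp add: f_def power_mult_distrib exp_of_nat2_mult[symmetric] mult.commute)
    ultimately have "f C = (q - 1) * exp (- B * real (card C))" by (simp add: mult.commute)
    then show ?thesis using False by simp
  qed
  have "(\<Prod>C\<in>K. 1 + (q - 1) * exp (- B * real (card C)))
      \<le> (\<Prod>C\<in>K. (if C \<in> L then q else 1) * (1 + f C))"
    using le q by (intro prod_mono) auto
  also have "\<dots> = q ^ card L * (\<Prod>C\<in>K. 1 + f C)"
    using finK LK by (simp add: prod.distrib prod.If_cases Int_absorb1)
  also have "\<dots> \<le> q powr ?N * (\<Prod>C\<in>K. 1 + f C)"
  proof (rule mult_right_mono)
    have "q ^ card L = q powr real (card L)" using q by (simp add: powr_realpow)
    also have "\<dots> \<le> q powr ?N"
      using card_nontree_components_le[OF g, of A m] A m q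
      by (intro powr_mono) (auto simp: L_def K_def)
    finally show "q ^ card L \<le> q powr ?N" .
    show "0 \<le> (\<Prod>C\<in>K. 1 + f C)" using f0 by (intro prod_nonneg) (simp add: add_nonneg_nonneg)
  qed
  finally have "(\<Prod>C\<in>K. 1 + (q - 1) * exp (- B * real (card C))) \<le> q powr ?N * (\<Prod>C\<in>K. 1 + f C)" .
  from mult_left_mono[OF this, of "w ^ card A"] w
  show "w ^ card A * (\<Prod>C\<in>components (verts g) A. 1 + (q - 1) * exp (- B * real (card C)))
    \<le> q powr ?N * (w ^ card A * (\<Prod>C\<in>components (verts g) A.
        1 + (exp (- B) * (q - 1)) ^ card C / (q - 1) ^ card {e \<in> A. e \<subseteq> C}))"
    by (simp add: K_def f_def mult.left_commute)
qed

text \<open>The two pressures differ by the explicit constant up to an error of at most \<open>ln q\<close> times the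
  density of components that are not trees. The real number \<open>x\<close> stands for the Ising limit.\<close>

lemma ln_Z_RC_approx:
  assumes g: "finite_simple_graph g" "regular_graph d g" "verts g \<noteq> {}"
    and q: "q \<ge> 2" and w: "w \<ge> 0" and B: "B \<ge> 0" and m: "m > 0"
    and \<beta>: "exp \<beta> = 1 + w" and \<gamma>: "exp \<gamma> = 1 + w / (q - 1)"
  shows "\<bar>ln (Z_RC g q w B) / real (card (verts g))
      - ((\<beta> + \<gamma>) / 4 * real d / 2 + ln (exp (- B) * (q - 1)) / 2 + x)\<bar>
    \<le> \<bar>ln (Z_Ising g ((\<beta> + \<gamma>) / 4) (real d * (\<beta> - \<gamma>) / 4 - ln (exp (- B) * (q - 1)) / 2))
          / real (card (verts g)) - x\<bar>
      + ln q * \<bar>real (card {v \<in> verts g. is_tree (nbhd g (m\<^sup>2) v)}) / real (card (verts g)) - 1\<bar>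
      + ln q / real m"
proof -
  define n where "n = real (card (verts g))"
  define a where "a = (\<beta> + \<gamma>) / 4 * real d / 2 + ln (exp (- B) * (q - 1)) / 2"
  define Z where "Z = Z_Ising g ((\<beta> + \<gamma>) / 4) (real d * (\<beta> - \<gamma>) / 4 - ln (exp (- B) * (q - 1)) / 2)"
  define good where "good = {v \<in> verts g. is_tree (nbhd g (m\<^sup>2) v)}"
  define bad where "bad = {v \<in> verts g. \<not> is_tree (nbhd g (m\<^sup>2) v)}"
  have fin: "finite (verts g)" using g by (simp add: finite_simple_graph_def)
  have n: "n > 0" using g fin by (simp add: n_def card_gt_0_iff)
  have Zpos: "Z > 0" unfolding Z_def by (rule Z_Ising_pos[OF g(1)])
  have R: "Z_rank2 g q w B = exp (n * a) * Z"
    unfolding n_def a_def Z_def by (rule Z_rank2_eq_Z_Ising[OF g(1,2) _ \<beta> \<gamma>]) (use q in simp)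
  then have Rpos: "Z_rank2 g q w B > 0" using Zpos by simp
  have lnR: "ln (Z_rank2 g q w B) = n * a + ln Z" unfolding R using Zpos by (simp add: ln_mult)
  have low: "n * a + ln Z \<le> ln (Z_RC g q w B)"
    using Z_rank2_le_Z_RC[OF g(1) q w, of B] Rpos lnR by (metis ln_mono order_less_le_trans)
  have "ln (Z_RC g q w B) \<le> ln (q powr (real (card bad) + n / real m) * Z_rank2 g q w B)"
    using Z_RC_le_Z_rank2[OF g(1) q w B m] Z_rank2_le_Z_RC[OF g(1) q w, of B] Rpos q
    unfolding bad_def n_def by (intro ln_mono) auto
  also have "\<dots> = (real (card bad) + n / real m) * ln q + (n * a + ln Z)"
    using Rpos q by (simp add: ln_mult ln_powr lnR)
  finally have up: "ln (Z_RC g q w B) \<le> (real (card bad) + n / real m) * ln q + (n * a + ln Z)" .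
  have "good \<union> bad = verts g" "good \<inter> bad = {}" by (auto simp: good_def bad_def)
  then have "n = real (card good) + real (card bad)"
    using fin by (metis card_Un_disjoint finite_Un n_def of_nat_add)
  then have frac: "\<bar>real (card good) / n - 1\<bar> = real (card bad) / n"
    using n by (simp add: field_simps)
  have "(n * a + ln Z) / n \<le> ln (Z_RC g q w B) / n"
    using low n by (intro divide_right_mono) auto
  then have "a + ln Z / n \<le> ln (Z_RC g q w B) / n" using n by (simp add: add_divide_distrib)
  moreover have "ln (Z_RC g q w B) / n \<le> ((real (card bad) + n / real m) * ln q + (n * a + ln Z)) / n"
    using up n by (intro divide_right_mono) auto
  moreover have "((real (card bad) + n / real m) * ln q + (n * a + ln Z)) / n
      = ln q * (real (card bad) / n) + ln q / real m + a + ln Z / n"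
    using n m by (simp add: field_simps)
  ultimately have "\<bar>ln (Z_RC g q w B) / n - (a + x)\<bar>
      \<le> \<bar>ln Z / n - x\<bar> + ln q * \<bar>real (card good) / n - 1\<bar> + ln q / real m"
    unfolding frac by linarith
  then show ?thesis unfolding n_def a_def Z_def good_def .
qed

section \<open>Convergence in probability\<close>

text \<open>The limits are taken first in \<open>n\<close> and then in \<open>m\<close>. Membership in the support of \<open>G n\<close>
  makes the regularity of the graphs available in the hypothesis.\<close>

lemma tendsto_in_prob_of_approx:
  assumes Y: "tendsto_in_prob I G Y y" and T: "\<And>m. tendsto_in_prob I G (T m) u"
    and K: "K > 0"
    and approx: "\<And>m n g. \<lbrakk>m > 0; n \<in> I; n > 0; g \<in> set_pmf (G n)\<rbrakk> \<Longrightarrow>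
      \<bar>X n g - x\<bar> \<le> \<bar>Y n g - y\<bar> + K * \<bar>T m n g - u\<bar> + K / real m"
  shows "tendsto_in_prob I G X x"
  unfolding tendsto_in_prob_def
proof (intro allI impI)
  fix \<epsilon> :: real assume \<epsilon>: "\<epsilon> > 0"
  obtain m :: nat where m: "3 * K / \<epsilon> < real m" using reals_Archimedean2 by blast
  then have m0: "m > 0" using K \<epsilon> by (metis divide_pos_pos gr0I less_asym mult_pos_pos of_nat_0 zero_less_numeral)
  have mK: "K / real m < \<epsilon> / 3" using m m0 \<epsilon> by (simp add: field_simps)
  define \<delta> where "\<delta> = \<epsilon> / (3 * K)"
  have \<delta>: "\<delta> > 0" "K * \<delta> = \<epsilon> / 3" using \<epsilon> K by (auto simp: \<delta>_def)
  let ?F = "inf sequentially (principal I)"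
  let ?p = "\<lambda>n. measure_pmf.prob (G n) {g. \<bar>Y n g - y\<bar> > \<epsilon> / 3}
    + measure_pmf.prob (G n) {g. \<bar>T m n g - u\<bar> > \<delta>}"
  have "(?p \<longlongrightarrow> 0 + 0) ?F"
    using Y T[of m] \<epsilon> \<delta> unfolding tendsto_in_prob_def by (intro tendsto_add) auto
  then have lim: "(?p \<longlongrightarrow> 0) ?F" by simp
  have "measure_pmf.prob (G n) {g. \<bar>X n g - x\<bar> > \<epsilon>} \<le> ?p n" if n: "n \<in> I" "n > 0" for n
  proof -
    have "\<bar>Y n g - y\<bar> > \<epsilon> / 3 \<or> \<bar>T m n g - u\<bar> > \<delta>"
      if g: "g \<in> set_pmf (G n)" and X: "\<bar>X n g - x\<bar> > \<epsilon>" for g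
    proof (rule ccontr)
      assume "\<not> ?thesis"
      then have "\<bar>Y n g - y\<bar> \<le> \<epsilon> / 3" "K * \<bar>T m n g - u\<bar> \<le> K * \<delta>" using K by auto
      with approx[OF m0 n g] mK \<delta>(2) X show False by linarith
    qed
    then have "measure_pmf.prob (G n) {g. \<bar>X n g - x\<bar> > \<epsilon>}
      \<le> measure_pmf.prob (G n) ({g. \<bar>Y n g - y\<bar> > \<epsilon> / 3} \<union> {g. \<bar>T m n g - u\<bar> > \<delta>})"
      by (intro measure_pmf.finite_measure_mono_AE) (auto simp: AE_measure_pmf_iff)
    also have "\<dots> \<le> ?p n" by (intro measure_Un_le) auto
    finally show ?thesis .
  qed
  then have "\<forall>\<^sub>F n in ?F. measure_pmf.prob (G n) {g. \<bar>X n g - x\<bar> > \<epsilon>} \<le> ?p n"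
    unfolding eventually_inf_principal by (intro eventually_mono[OF eventually_gt_at_top[of 0]]) blast
  then show "((\<lambda>n. measure_pmf.prob (G n) {g. \<bar>X n g - x\<bar> > \<epsilon>}) \<longlongrightarrow> 0) ?F"
    by (intro tendsto_sandwich[OF _ _ tendsto_const lim]) auto
qed

theorem theorem1p11:
  fixes d :: nat and I :: "nat set" and G :: "nat \<Rightarrow> nat graph pmf"
    and \<phi>_Ising :: "real \<Rightarrow> real \<Rightarrow> real"
    and q w B \<beta> \<beta>' B' :: real
  assumes "d \<ge> 1"
    and "regular_graph_seq d I G"
    and "locally_tree_like I G"
    and "is_Ising_pressure d \<phi>_Ising"
    and "q \<ge> 2" and "w \<ge> 0" and "B \<ge> 0"
    and "w = exp \<beta> - 1"
    and "\<beta>' = \<beta> / 4 + 1 / 4 * ln (1 + (exp \<beta> - 1) / (q - 1))"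
    and "B' = real d / 4 * ln ((1 + w) / (1 + w / (q - 1))) + 1 / 2 * ln (exp B / (q - 1))"
  shows "tendsto_in_prob I G (\<lambda>n g. ln (Z_RC g q w B) / real n)
           (\<beta>' * real d / 2 + 1 / 2 * ln (exp (- B) * (q - 1)) + \<phi>_Ising \<beta>' B')"
proof -
  define \<gamma> where "\<gamma> = ln (1 + w / (q - 1))"
  define t where "t = exp (- B) * (q - 1)"
  have wq: "w / (q - 1) \<ge> 0" using assms by simp
  have \<beta>: "exp \<beta> = 1 + w" using assms by simp
  have \<gamma>: "exp \<gamma> = 1 + w / (q - 1)" unfolding \<gamma>_def using wq by simp
  have \<beta>': "\<beta>' = (\<beta> + \<gamma>) / 4" using assms(8,9) by (simp add: \<gamma>_def)
  have "ln ((1 + w) / (1 + w / (q - 1))) = \<beta> - \<gamma>"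
    unfolding \<beta>[symmetric] \<gamma>[symmetric] exp_diff[symmetric] by simp
  moreover have "ln (exp B / (q - 1)) = - ln t"
    using assms(5) by (simp add: t_def ln_div ln_mult)
  ultimately have B': "B' = real d * (\<beta> - \<gamma>) / 4 - ln t / 2" using assms(10) by simp
  have "exp \<beta> \<ge> 1" "exp \<gamma> \<ge> 1" using \<beta> \<gamma> assms(6) wq by auto
  then have "\<beta>' \<ge> 0" unfolding \<beta>' by simp
  then have Ising: "tendsto_in_prob I G (\<lambda>n g. ln (Z_Ising g \<beta>' B') / real n) (\<phi>_Ising \<beta>' B')"
    using assms(2-4) unfolding is_Ising_pressure_def by blast
  show ?thesis
  proof (rule tendsto_in_prob_of_approx[OF Ising])
    show "tendsto_in_prob I G
        (\<lambda>n g. real (card {v \<in> verts g. is_tree (nbhd g (m\<^sup>2) v)}) / real n) 1" for m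
      using assms(3) unfolding locally_tree_like_def by blast
    show "ln q > 0" using assms(5) by simp
    fix m n :: nat and g :: "nat graph"
    assume m: "m > 0" and n: "n \<in> I" "n > 0" and "g \<in> set_pmf (G n)"
    then have g: "finite_simple_graph g" "regular_graph d g" "card (verts g) = n"
      using assms(2) unfolding regular_graph_seq_def by auto
    then have "verts g \<noteq> {}" using n by auto
    from ln_Z_RC_approx[OF g(1,2) this assms(5-7) m \<beta> \<gamma>, of "\<phi>_Ising \<beta>' B'"]
    show "\<bar>ln (Z_RC g q w B) / real n
        - (\<beta>' * real d / 2 + 1 / 2 * ln (exp (- B) * (q - 1)) + \<phi>_Ising \<beta>' B')\<bar>
      \<le> \<bar>ln (Z_Ising g \<beta>' B') / real n - \<phi>_Ising \<beta>' B'\<bar>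
        + ln q * \<bar>real (card {v \<in> verts g. is_tree (nbhd g (m\<^sup>2) v)}) / real n - 1\<bar> + ln q / real m"
      unfolding g(3) \<beta>' B' t_def by simp
  qed
qed

end
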